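(* If $T$ is a tree, then ${\rm gpack}(T)={\rm gt}(T)$.
   Context: A geodesic in a graph $G$ is a shortest path between its end-vertices; it is maximal if it is not contained as a subpath in any other geodesic of $G$. A geodesic packing of $G$ is a set of pairwise vertex-disjoint maximal geodesics of $G$, and ${\rm gpack}(G)$ is the maximum cardinality of a geodesic packing of $G$. A set $S\subseteq V(G)$ is a geodesic transversal of $G$ if every maximal geodesic of $G$ contains at least one vertex of $S$, and ${\rm gt}(G)$ is the minimum cardinality of a geodesic transversal of $G$. *)

theory Defs
  imports "Graph_Theory.Graph_Theory" "HOL-Library.Sublist"
begin

text \<open>
  A finite simple undirected graph is a symmetric digraph \<open>G\<close> with \<open>graph G\<close>: finite, without loops
  and without parallel arcs, each edge being a pair of opposite arcs. The library's \<open>tree\<close> cannot be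
  used for such a graph, because \<open>forest\<close> counts a pair of opposite arcs as a cycle; cycles of an
  undirected graph have length at least 3.
\<close>

definition undirected_cycle :: "('a, 'b) pre_digraph \<Rightarrow> 'a vwalk \<Rightarrow> bool" where
  "undirected_cycle G c \<longleftrightarrow>
     vwalk c G \<and> hd c = last c \<and> distinct (tl c) \<and> 3 \<le> vwalk_length c"

definition undirected_tree :: "('a, 'b) pre_digraph \<Rightarrow> bool" where
  "undirected_tree G \<longleftrightarrow> graph G \<and> connected G \<and> (\<nexists>c. undirected_cycle G c)"

text \<open>
  Paths are given by their vertex sequences, so a path of an undirected graph corresponds to a
  sequence and its reversal. This affects neither maximality (the reversal of a geodesic is a geodesic,
  so containment in \<open>rev q\<close> is covered by quantifying over all geodesics) nor the cardinality
  of packings (a path and its reversal are not disjoint).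
\<close>

definition geodesic :: "('a, 'b) pre_digraph \<Rightarrow> 'a vwalk \<Rightarrow> bool" where
  "geodesic G p \<longleftrightarrow> vpath p G \<and>
     (\<forall>q. vpath q G \<and> hd q = hd p \<and> last q = last p \<longrightarrow> vwalk_length p \<le> vwalk_length q)"

definition maximal_geodesic :: "('a, 'b) pre_digraph \<Rightarrow> 'a vwalk \<Rightarrow> bool" where
  "maximal_geodesic G p \<longleftrightarrow> geodesic G p \<and> (\<nexists>q. geodesic G q \<and> strict_sublist p q)"

definition geodesic_packing :: "('a, 'b) pre_digraph \<Rightarrow> 'a vwalk set \<Rightarrow> bool" where
  "geodesic_packing G P \<longleftrightarrow>
     (\<forall>p\<in>P. maximal_geodesic G p) \<and> (\<forall>p\<in>P. \<forall>q\<in>P. p \<noteq> q \<longrightarrow> set p \<inter> set q = {})"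

definition gpack :: "('a, 'b) pre_digraph \<Rightarrow> nat" where
  "gpack G = Max {card P |P. geodesic_packing G P}"

definition geodesic_transversal :: "('a, 'b) pre_digraph \<Rightarrow> 'a set \<Rightarrow> bool" where
  "geodesic_transversal G S \<longleftrightarrow>
     S \<subseteq> verts G \<and> (\<forall>p. maximal_geodesic G p \<longrightarrow> set p \<inter> S \<noteq> {})"

definition gt :: "('a, 'b) pre_digraph \<Rightarrow> nat" where
  "gt G = Min {card S |S. geodesic_transversal G S}"

text \<open>In a finite graph the maximum and the minimum above are attained.\<close>

lemma (in fin_digraph) finite_maximal_geodesics: "finite {p. maximal_geodesic G p}"
proof (rule finite_subset)
  show "{p. maximal_geodesic G p} \<subseteq> {p. set p \<subseteq> verts G \<and> distinct p}"
    by (auto simp: maximal_geodesic_def geodesic_def vpath_def vwalk_def)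
  show "finite {p. set p \<subseteq> verts G \<and> distinct p}"
    by (rule finite_subset_distinct) simp
qed

lemma (in fin_digraph) gpack_attained: "\<exists>P. geodesic_packing G P \<and> finite P \<and> card P = gpack G"
proof -
  have sub: "{P. geodesic_packing G P} \<subseteq> Pow {p. maximal_geodesic G p}"
    by (auto simp: geodesic_packing_def)
  then have "finite {P. geodesic_packing G P}"
    using finite_maximal_geodesics finite_subset by blast
  then have "finite {card P |P. geodesic_packing G P}"
    by simp
  moreover have "geodesic_packing G {}"
    by (simp add: geodesic_packing_def)
  ultimately have "gpack G \<in> {card P |P. geodesic_packing G P}"
    unfolding gpack_def by (intro Max_in) auto
  then obtain P where P: "geodesic_packing G P" "card P = gpack G"
    by auto
  with sub have "P \<subseteq> {p. maximal_geodesic G p}"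
    by auto
  with P show ?thesis
    using finite_maximal_geodesics finite_subset by blast
qed

lemma (in fin_digraph) gt_attained: "\<exists>S. geodesic_transversal G S \<and> card S = gt G"
proof -
  have "{S. geodesic_transversal G S} \<subseteq> Pow (verts G)"
    by (auto simp: geodesic_transversal_def)
  then have "finite {S. geodesic_transversal G S}"
    using finite_subset by fastforce
  then have "finite {card S |S. geodesic_transversal G S}"
    by simp
  moreover have "geodesic_transversal G (verts G)"
    by (auto simp: geodesic_transversal_def maximal_geodesic_def geodesic_def vpath_def vwalk_def
        neq_Nil_conv)
  ultimately have "gt G \<in> {card S |S. geodesic_transversal G S}"
    unfolding gt_def by (intro Min_in) auto
  then show ?thesis by auto
qed

end

theory Submission
  imports Defs
begin

text \<open>
  This is the min-max property of subtrees of a tree, applied to paths. Root the tree. Every path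
  has a top vertex, its vertex closest to the root, and the path from the root to any vertex of
  the given path passes through that top and stays inside the path afterwards. Hence, if two paths
  meet, the deeper of their two tops lies on both of them. Greedily choosing a path whose top is
  deepest, and discarding all paths that meet it, therefore produces a packing whose tops form a
  transversal. The reverse inequality is trivial.
\<close>

section \<open>Greedy packings in a family of sets with depths\<close>

text \<open>The greedy argument abstracted from trees: the third assumption carries all the tree
  structure. A set \<open>A m\<close> of greatest depth joins the packing; every set it displaces
  meets \<open>A m\<close> and hence contains \<open>top m\<close>.\<close>

lemma greedy_packing_transversal:
  fixes A :: "'i \<Rightarrow> 'v set" and top :: "'i \<Rightarrow> 'v" and depth :: "'i \<Rightarrow> nat"
  assumes "finite F"
    and "\<And>i. i \<in> F \<Longrightarrow> top i \<in> A i"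
    and "\<And>i j. \<lbrakk>i \<in> F; j \<in> F; A i \<inter> A j \<noteq> {}; depth j \<le> depth i\<rbrakk> \<Longrightarrow> top i \<in> A j"
  shows "\<exists>P\<subseteq>F. (\<forall>i\<in>P. \<forall>j\<in>P. i \<noteq> j \<longrightarrow> A i \<inter> A j = {}) \<and> (\<forall>j\<in>F. A j \<inter> top ` P \<noteq> {})"
  using assms
proof (induction F rule: finite_psubset_induct)
  case (psubset F)
  show ?case
  proof (cases "F = {}")
    case False
    obtain m where m: "m \<in> F" "\<And>j. j \<in> F \<Longrightarrow> depth j \<le> depth m"
      using obtains_MAX[OF \<open>finite F\<close> False, of depth] \<open>finite F\<close>
      by (metis Max_ge finite_imageI imageI)
    define F' where "F' = {j\<in>F. A m \<inter> A j = {}}"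
    \<comment> \<open>\<open>A m\<close> contains \<open>top m\<close>, so it is nonempty and meets
      itself; this makes \<open>F'\<close> a proper subset.\<close>
    have "m \<notin> F'"
      using m(1) psubset.prems(1) by (auto simp: F'_def)
    then have "F' \<subset> F"
      using m(1) by (auto simp: F'_def)
    moreover have "\<And>i. i \<in> F' \<Longrightarrow> top i \<in> A i"
      using psubset.prems(1) by (simp add: F'_def)
    moreover have "\<And>i j. \<lbrakk>i \<in> F'; j \<in> F'; A i \<inter> A j \<noteq> {}; depth j \<le> depth i\<rbrakk> \<Longrightarrow> top i \<in> A j"
      using psubset.prems(2) by (simp add: F'_def)
    ultimately have "\<exists>P\<subseteq>F'. (\<forall>i\<in>P. \<forall>j\<in>P. i \<noteq> j \<longrightarrow> A i \<inter> A j = {}) \<and>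
        (\<forall>j\<in>F'. A j \<inter> top ` P \<noteq> {})"
      by (rule psubset.IH)
    then obtain P where P: "P \<subseteq> F'"
      "\<forall>i\<in>P. \<forall>j\<in>P. i \<noteq> j \<longrightarrow> A i \<inter> A j = {}" "\<forall>j\<in>F'. A j \<inter> top ` P \<noteq> {}"
      by (elim exE conjE)
    have "insert m P \<subseteq> F"
      using P(1) m(1) by (auto simp: F'_def)
    moreover have "\<forall>i\<in>insert m P. \<forall>j\<in>insert m P. i \<noteq> j \<longrightarrow> A i \<inter> A j = {}"
      using P(1,2) by (fastforce simp: F'_def)
    moreover have "\<forall>j\<in>F. A j \<inter> top ` insert m P \<noteq> {}"
    proof
      fix j assume j: "j \<in> F"
      \<comment> \<open>A member of \<open>F'\<close> is hit by the tops of \<open>P\<close>; any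
        other \<open>A j\<close> meets \<open>A m\<close> and, \<open>m\<close> being deepest,
        contains \<open>top m\<close>.\<close>
      show "A j \<inter> top ` insert m P \<noteq> {}"
        using P(3) j psubset.prems(2)[OF m(1) j] m(2)[OF j] by (cases "j \<in> F'") (auto simp: F'_def)
    qed
    ultimately show ?thesis
      by (intro exI[of _ "insert m P"] conjI)
  qed auto
qed

section \<open>Cutting, gluing and reversing paths\<close>

text \<open>Replaces the arc list of a walk by a chain condition on consecutive vertices, which
  splits along appends and behaves well under \<open>rev\<close>.\<close>

lemma vwalk_iff_successively:
  "vwalk p G \<longleftrightarrow> p \<noteq> [] \<and> set p \<subseteq> verts G \<and> successively (\<lambda>x y. (x, y) \<in> arcs_ends G) p"
proof -
  have "set (vwalk_arcs p) \<subseteq> arcs_ends G \<longleftrightarrow> successively (\<lambda>x y. (x, y) \<in> arcs_ends G) p"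
    by (induction p rule: vwalk_arcs.induct) auto
  then show ?thesis
    by (auto simp: vwalk_def)
qed

lemma (in sym_digraph) successively_rev_arcs_ends:
  "successively (\<lambda>x y. (x, y) \<in> arcs_ends G) (rev p) \<longleftrightarrow>
   successively (\<lambda>x y. (x, y) \<in> arcs_ends G) p"
proof -
  have "(\<lambda>x y. (y, x) \<in> arcs_ends G) = (\<lambda>x y. (x, y) \<in> arcs_ends G)"
    using sym_arcs by (auto simp: symmetric_def fun_eq_iff dest: symD)
  then show ?thesis
    by (simp only: successively_rev)
qed

lemma (in sym_digraph) vpath_rev: "vpath (rev p) G \<longleftrightarrow> vpath p G"
  unfolding vpath_def vwalk_iff_successively successively_rev_arcs_ends by simp

text \<open>The required path is the segment of \<open>p\<close> between \<open>w\<close> and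
  \<open>u\<close>, read backwards if \<open>u\<close> comes before \<open>w\<close>.\<close>

lemma (in sym_digraph) vpath_within_path:
  assumes "vpath p G" "w \<in> set p" "u \<in> set p"
  obtains q where "vpath (w # q) G" "last (w # q) = u" "set (w # q) \<subseteq> set p"
proof -
  have forward: "\<exists>q. vpath (w # q) G \<and> last (w # q) = u \<and> set (w # q) \<subseteq> set p'"
    if p': "vpath p' G" "p' = xs @ w # ys" and u: "u \<in> set (w # ys)" for p' xs ys
  proof (cases "u = w")
    case True
    then show ?thesis
      using p' by (intro exI[of _ "[]"]) (auto simp: vpath_def vwalk_iff_successively)
  next
    case False
    then obtain y1 y2 where "ys = y1 @ u # y2"
      using u by (auto dest: split_list)
    then show ?thesis
      using p'
      by (intro exI[of _ "y1 @ [u]"])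
        (auto simp: vpath_def vwalk_iff_successively successively_append_iff successively_Cons hd_append)
  qed
  obtain xs ys where p: "p = xs @ w # ys"
    using assms(2) by (auto dest: split_list)
  show thesis
  proof (cases "u \<in> set (w # ys)")
    case True
    then show ?thesis
      using forward[OF assms(1) p] that by blast
  next
    case False
    then have "u \<in> set (w # rev xs)"
      using assms(3) p by auto
    moreover have "vpath (rev p) G"
      using assms(1) vpath_rev by blast
    moreover have "rev p = rev ys @ w # rev xs"
      by (simp add: p)
    ultimately show ?thesis
      using forward[of "rev p"] that by (metis set_rev)
  qed
qed

section \<open>Unique paths, and the top of a path in a rooted tree\<close>

text \<open>After the common start, two different paths diverge and later meet again; going out
  along one and back along the other gives a cycle. The induction strips common first
  vertices.\<close>

lemma (in sym_digraph) acyclic_vpath_unique: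
  assumes "\<nexists>c. undirected_cycle G c"
    and "vpath p G" "vpath q G" "hd p = hd q" "last p = last q"
  shows "p = q"
  using assms(2-)
proof (induction p arbitrary: q)
  case Nil
  then show ?case
    by (simp add: vpath_def vwalk_def)
next
  case (Cons x p')
  then obtain q' where q: "q = x # q'"
    by (cases q) (auto simp: vpath_def vwalk_def)
  \<comment> \<open>If only one tail were empty, the other path would end in \<open>x\<close> again
    and repeat a vertex.\<close>
  have nil_iff: "p' = [] \<longleftrightarrow> q' = []"
    using Cons.prems unfolding q vpath_def
    by (metis distinct.simps(2) last.simps last_in_set)
  show ?case
  proof (cases "p' = []")
    case True
    then show ?thesis
      using nil_iff q by simp
  next
    case False
    with nil_iff have ne: "p' \<noteq> []" "q' \<noteq> []"
      by auto
    have "hd p' = hd q'"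
    proof (rule ccontr)
      assume heads: "hd p' \<noteq> hd q'"
      have "last p' = last q'"
        using Cons.prems(4) q ne by simp
      then have "\<exists>z\<in>set p'. z \<in> set q'"
        using ne last_in_set by metis
      \<comment> \<open>Taking \<open>z\<close> as the first vertex of \<open>p'\<close> on
        \<open>q'\<close> keeps \<open>p1\<close> disjoint from \<open>q1\<close>, so the closed
        walk through \<open>x\<close> and \<open>z\<close> repeats only \<open>x\<close>.\<close>
      then obtain p1 z p2 where p': "p' = p1 @ z # p2" "z \<in> set q'" "\<forall>y\<in>set p1. y \<notin> set q'"
        by (rule split_list_first_propE)
      then obtain q1 q2 where q': "q' = q1 @ z # q2"
        by (meson split_list)
      have "successively (\<lambda>x y. (x, y) \<in> arcs_ends G) (x # q1 @ [z])"
        using Cons.prems(2) unfolding q q' vpath_def vwalk_iff_successively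
        by (auto simp: successively_append_iff successively_Cons hd_append)
      then have "successively (\<lambda>x y. (x, y) \<in> arcs_ends G) (z # rev q1 @ [x])"
        using successively_rev_arcs_ends[of "x # q1 @ [z]"] by simp
      moreover have "successively (\<lambda>x y. (x, y) \<in> arcs_ends G) (x # p1 @ [z])"
        using Cons.prems(1) unfolding p' vpath_def vwalk_iff_successively
        by (auto simp: successively_append_iff successively_Cons hd_append)
      ultimately have "successively (\<lambda>x y. (x, y) \<in> arcs_ends G) ((x # p1) @ z # rev q1 @ [x])"
        by (auto simp: successively_append_iff successively_Cons hd_append)
      then have "vwalk (x # p1 @ z # rev q1 @ [x]) G"
        using Cons.prems(1,2) unfolding q q' p' vpath_def vwalk_iff_successively by auto
      moreover have "distinct (p1 @ z # rev q1 @ [x])"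
        using Cons.prems(1,2) p'(3) unfolding q q' p'(1) vpath_def by auto
      \<comment> \<open>Otherwise both tails would start with \<open>z\<close>. This excludes the
        walk \<open>x\<close>, \<open>z\<close>, \<open>x\<close> of length 2, which is no
        cycle.\<close>
      moreover have "p1 \<noteq> [] \<or> q1 \<noteq> []"
        using heads p'(1) q' by auto
      then have "3 \<le> vwalk_length (x # p1 @ z # rev q1 @ [x])"
        by (cases p1; cases q1) (auto simp: vwalk_length_def)
      ultimately have "undirected_cycle G (x # p1 @ z # rev q1 @ [x])"
        by (simp add: undirected_cycle_def)
      then show False
        using assms(1) by blast
    qed
    moreover have "vpath p' G" "vpath q' G"
      using Cons.prems(1,2) ne unfolding q vpath_def vwalk_iff_successively
      by (auto simp: successively_Cons)
    ultimately show ?thesis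
      using Cons.IH[of q'] Cons.prems(4) ne q by simp
  qed
qed

text \<open>Walk from \<open>r\<close> towards some vertex of \<open>p\<close> and stop at the first
  vertex \<open>w\<close> on \<open>p\<close>. Since \<open>R\<close> avoids \<open>p\<close>,
  continuing inside \<open>p\<close> reaches any \<open>u\<close> by a path, and by uniqueness this
  is the path from \<open>r\<close> to \<open>u\<close>. Thus \<open>R\<close> and \<open>w\<close>
  do not depend on \<open>u\<close>.\<close>

lemma (in sym_digraph) path_top_exists:
  assumes "\<nexists>c. undirected_cycle G c" "connected G" "r \<in> verts G" "vpath p G"
  obtains R w where "w \<in> set p"
    "\<And>u s. \<lbrakk>u \<in> set p; vpath s G; hd s = r; last s = u\<rbrakk> \<Longrightarrow>
       \<exists>q. s = R @ w # q \<and> set q \<subseteq> set p"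
proof -
  obtain v where v: "v \<in> set p" "v \<in> verts G"
    using assms(4) by (cases p) (auto simp: vpath_def vwalk_def)
  have "strongly_connected G"
    using assms(2) sym_arcs by (rule symmetric_connected_imp_strongly_connected[rotated])
  then have "r \<rightarrow>\<^sup>* v"
    using assms(3) v(2) by (auto simp: strongly_connected_def)
  then obtain s0 where s0: "vpath s0 G" "hd s0 = r" "last s0 = v"
    by (auto simp: reachable_vpath_conv)
  then have "\<exists>x\<in>set s0. x \<in> set p"
    using v(1) by (metis last_in_set vpath_def vwalk_def)
  then obtain R w q0 where R: "s0 = R @ w # q0" "w \<in> set p" "\<forall>y\<in>set R. y \<notin> set p"
    by (rule split_list_first_propE)
  have "\<exists>q. s = R @ w # q \<and> set q \<subseteq> set p"
    if u: "u \<in> set p" and s: "vpath s G" "hd s = r" "last s = u" for u s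
  proof -
    obtain q where q: "vpath (w # q) G" "last (w # q) = u" "set (w # q) \<subseteq> set p"
      using vpath_within_path[OF assms(4) R(2) u] by blast
    \<comment> \<open>No vertex repeats: \<open>R\<close> avoids \<open>p\<close>, while
      \<open>w # q\<close> lies inside \<open>p\<close>.\<close>
    have "vpath (R @ w # q) G"
      using s0(1) q R(3) unfolding R(1) vpath_def vwalk_iff_successively
      by (auto simp: successively_append_iff)
    moreover have "hd (R @ w # q) = hd s"
      using s0(2) s(2) unfolding R(1) by (cases R) auto
    moreover have "last (R @ w # q) = last s"
      using q(2) s(3) by simp
    ultimately have "R @ w # q = s"
      using acyclic_vpath_unique[OF assms(1) _ s(1)] by blast
    then show ?thesis
      using q(3) by auto
  qed
  then show thesis
    using that R(2) by blast
qed

section \<open>Bounds between packings and transversals\<close>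

text \<open>Weak duality: a transversal has a vertex on each path of a packing, and disjointness
  makes these vertices distinct.\<close>

lemma (in fin_digraph) gpack_le_gt: "gpack G \<le> gt G"
proof -
  obtain P where P: "geodesic_packing G P" "finite P" "card P = gpack G"
    using gpack_attained by blast
  obtain S where S: "geodesic_transversal G S" "card S = gt G"
    using gt_attained by blast
  have "\<forall>p\<in>P. \<exists>x. x \<in> set p \<inter> S"
    using P(1) S(1) unfolding geodesic_packing_def geodesic_transversal_def by blast
  then obtain f where f: "\<And>p. p \<in> P \<Longrightarrow> f p \<in> set p \<inter> S"
    by metis
  have "inj_on f P"
  proof (rule inj_onI, rule ccontr)
    fix p q assume "p \<in> P" "q \<in> P" "f p = f q" "p \<noteq> q"
    then show False
      using f[of p] f[of q] P(1) unfolding geodesic_packing_def by auto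
  qed
  moreover have "finite S"
    using S(1) finite_verts unfolding geodesic_transversal_def by (blast intro: finite_subset)
  ultimately have "card P \<le> card S"
    using f by (intro card_inj_on_le[of f]) auto
  then show ?thesis
    using P(3) S(2) by simp
qed

lemma (in fin_digraph) card_packing_le_gpack:
  assumes "geodesic_packing G P"
  shows "card P \<le> gpack G"
proof -
  have "{P. geodesic_packing G P} \<subseteq> Pow {p. maximal_geodesic G p}"
    by (auto simp: geodesic_packing_def)
  then have "finite {P. geodesic_packing G P}"
    using finite_maximal_geodesics finite_subset by blast
  then show ?thesis
    unfolding gpack_def using assms by (intro Max_ge) auto
qed

lemma (in fin_digraph) gt_le_card_transversal:
  assumes "geodesic_transversal G S"
  shows "gt G \<le> card S"
proof -
  have "{S. geodesic_transversal G S} \<subseteq> Pow (verts G)"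
    by (auto simp: geodesic_transversal_def)
  then have "finite {S. geodesic_transversal G S}"
    using finite_subset by fastforce
  then show ?thesis
    unfolding gt_def using assms by (intro Min_le) auto
qed

section \<open>The greedy argument on a rooted tree\<close>

theorem theorem3p4:
  fixes T :: "('a, 'b) pre_digraph"
  assumes "undirected_tree T"
  shows "gpack T = gt T"
proof -
  interpret graph T
    using assms by (simp add: undirected_tree_def)
  have acyclic: "\<nexists>c. undirected_cycle T c" and conn: "connected T"
    using assms by (simp_all add: undirected_tree_def)
  have strong: "strongly_connected T"
    using conn sym_arcs by (rule symmetric_connected_imp_strongly_connected[rotated])
  \<comment> \<open>\<open>strongly_connected\<close> includes that there is a vertex, so a root
    exists.\<close>
  then obtain r where r: "r \<in> verts T"
    by (auto simp: strongly_connected_def)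
  let ?F = "{p. maximal_geodesic T p}"
  have vpath: "vpath p T" if "p \<in> ?F" for p
    using that by (simp add: maximal_geodesic_def geodesic_def)
  have "\<exists>R w. w \<in> set p \<and> (\<forall>u s. u \<in> set p \<and> vpath s T \<and> hd s = r \<and> last s = u \<longrightarrow>
      (\<exists>q. s = R @ w # q \<and> set q \<subseteq> set p))" if "p \<in> ?F" for p
    using path_top_exists[OF acyclic conn r vpath[OF that]] by metis
  \<comment> \<open>\<open>R p\<close> is the part of the root path before \<open>top p\<close>, so
    \<open>length (R p)\<close> is the distance of \<open>top p\<close> from the root and serves as
    the depth.\<close>
  then obtain R top where top: "\<And>p. p \<in> ?F \<Longrightarrow> top p \<in> set p"
    and through: "\<And>p s. \<lbrakk>p \<in> ?F; last s \<in> set p; vpath s T; hd s = r\<rbrakk> \<Longrightarrow>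
      \<exists>q. s = R p @ top p # q \<and> set q \<subseteq> set p"
    by metis
  \<comment> \<open>The root path \<open>s\<close> to a common vertex passes through both tops. As
    \<open>top i\<close> is at least as deep as \<open>top j\<close>, it occurs on \<open>s\<close>
    at or after \<open>top j\<close>, and that part of \<open>s\<close> lies in
    \<open>j\<close>.\<close>
  have "top i \<in> set j"
    if ij: "i \<in> ?F" "j \<in> ?F" "set i \<inter> set j \<noteq> {}" "length (R j) \<le> length (R i)" for i j
  proof -
    obtain v where v: "v \<in> set i" "v \<in> set j"
      using ij(3) by blast
    then have "r \<rightarrow>\<^sup>*\<^bsub>T\<^esub> v"
      using vpath[OF ij(1)] strong r by (auto simp: strongly_connected_def vpath_def vwalk_def)
    then obtain s where s: "vpath s T" "hd s = r" "last s = v"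
      by (auto simp: reachable_vpath_conv)
    obtain q where q: "s = R i @ top i # q"
      using through[OF ij(1)] s v(1) by blast
    obtain q' where q': "s = R j @ top j # q'" "set q' \<subseteq> set j"
      using through[OF ij(2)] s v(2) by blast
    have "top i = s ! length (R i)"
      by (simp add: q)
    moreover have "s ! length (R i) = (top j # q') ! (length (R i) - length (R j))"
      using ij(4) by (simp add: q'(1) nth_append)
    \<comment> \<open>Both decompositions have the length of \<open>s\<close>, so the shifted
      position of \<open>top i\<close> is a valid index.\<close>
    moreover have "length (R i) - length (R j) < length (top j # q')"
      using arg_cong[OF q, of length] arg_cong[OF q'(1), of length] ij(4) by simp
    ultimately have "top i \<in> set (top j # q')"
      using nth_mem by metis
    then show ?thesis
      using q'(2) top[OF ij(2)] by auto
  qed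
  with greedy_packing_transversal[where A = set and depth = "\<lambda>p. length (R p)",
      OF finite_maximal_geodesics top]
  have "\<exists>P\<subseteq>?F. (\<forall>i\<in>P. \<forall>j\<in>P. i \<noteq> j \<longrightarrow> set i \<inter> set j = {}) \<and> (\<forall>j\<in>?F. set j \<inter> top ` P \<noteq> {})"
    by blast
  then obtain P where P: "P \<subseteq> ?F" "\<forall>i\<in>P. \<forall>j\<in>P. i \<noteq> j \<longrightarrow> set i \<inter> set j = {}"
    "\<forall>j\<in>?F. set j \<inter> top ` P \<noteq> {}"
    by (elim exE conjE)
  have "geodesic_packing T P"
    using P(1,2) by (auto simp: geodesic_packing_def)
  moreover have "geodesic_transversal T (top ` P)"
    using P(1,3) top vpath unfolding geodesic_transversal_def vpath_def vwalk_def by blast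
  moreover have "card (top ` P) \<le> card P"
    using P(1) finite_maximal_geodesics by (intro card_image_le) (rule finite_subset)
  ultimately have "gt T \<le> gpack T"
    using gt_le_card_transversal card_packing_le_gpack by (meson order_trans)
  with gpack_le_gt show ?thesis
    by simp
qed

end
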